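(* 1. The uniformly random graph $\mathbb G_n$ on vertex set $\{1,\dots,n\}$ is homotens with probability tending to $1$ as $n\to\infty$. 2. The Rado graph is homotens. 3. The complete graph $K_n$ is homotens whenever $n\ge5$. In particular, in the order $\preccurlyeq_{cc}$ we have $$K_3\approx_{cc}K_4\prec_{cc}K_5\prec_{cc}K_6\prec_{cc}K_7\prec_{cc}\cdots.$$
   Context: Graphs are undirected, simple and loopless; infinite graphs are allowed here. In $\mathbb G_n$ each of the $2^{\binom n2}$ graphs on $\{1,\dots,n\}$ is equally likely. The Rado graph is the countable random graph (unique up to isomorphism). A cut in a graph $G=(V,E)$ is the set of all edges with one end in $X$ and the other in $V\setminus X$, for some $X\subseteq V$ (so the empty set is a cut). A mapping $f:E(G)\to E(H)$ is cut-continuous if for every cut $C$ of $H$ the preimage $f^{-1}(C)$ is a cut of $G$. A mapping $f:E(G)\to E(H)$ is induced by a homomorphism if there is a graph homomorphism $h:V(G)\to V(H)$ with $f(uv)=h(u)h(v)$ for every edge $uv$ of $G$. A graph $G$ is homotens if for every graph $H$, every cut-continuous mapping $E(G)\to E(H)$ is induced by a homomorphism $G\to H$. Write $G\preccurlyeq_{cc}H$ if there is a cut-continuous mapping $E(G)\to E(H)$; $G\approx_{cc}H$ if $G\preccurlyeq_{cc}H$ and $H\preccurlyeq_{cc}G$; $G\prec_{cc}H$ if $G\preccurlyeq_{cc}H$ but not $H\preccurlyeq_{cc}G$. *)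

theory Defs
  imports "HOL-Probability.Probability"
begin

record 'a ugraph =
  verts :: "'a set"
  edges :: "'a set set"

definition simple_graph :: "'a ugraph \<Rightarrow> bool" where
  "simple_graph G \<longleftrightarrow> (\<forall>e\<in>edges G. e \<subseteq> verts G \<and> card e = 2)"

definition cut_of :: "'a ugraph \<Rightarrow> 'a set \<Rightarrow> 'a set set" where
  "cut_of G X = {e \<in> edges G. \<exists>u\<in>X. \<exists>v\<in>verts G - X. e = {u, v}}"

definition is_cut :: "'a ugraph \<Rightarrow> 'a set set \<Rightarrow> bool" where
  "is_cut G C \<longleftrightarrow> (\<exists>X\<subseteq>verts G. C = cut_of G X)"

definition cut_continuous :: "'a ugraph \<Rightarrow> 'b ugraph \<Rightarrow> ('a set \<Rightarrow> 'b set) \<Rightarrow> bool" where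
  "cut_continuous G H f \<longleftrightarrow>
     f \<in> edges G \<rightarrow> edges H \<and> (\<forall>C. is_cut H C \<longrightarrow> is_cut G {e \<in> edges G. f e \<in> C})"

definition graph_hom :: "'a ugraph \<Rightarrow> 'b ugraph \<Rightarrow> ('a \<Rightarrow> 'b) \<Rightarrow> bool" where
  "graph_hom G H h \<longleftrightarrow>
     h \<in> verts G \<rightarrow> verts H \<and> (\<forall>u v. {u, v} \<in> edges G \<longrightarrow> {h u, h v} \<in> edges H)"

definition induced_by_hom :: "'a ugraph \<Rightarrow> 'b ugraph \<Rightarrow> ('a set \<Rightarrow> 'b set) \<Rightarrow> bool" where
  "induced_by_hom G H f \<longleftrightarrow>
     (\<exists>h. graph_hom G H h \<and> (\<forall>u v. {u, v} \<in> edges G \<longrightarrow> f {u, v} = {h u, h v}))"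

text \<open>
  A definition cannot quantify over all vertex types of the target graph \<open>H\<close>, so that type is a
  parameter. By \<open>homotens_nat_imp\<close> below, for countable \<open>G\<close> the type \<^typ>\<open>nat\<close> already
  accounts for all graphs \<open>H\<close> over all types.
\<close>
definition homotens :: "'b itself \<Rightarrow> 'a ugraph \<Rightarrow> bool" where
  "homotens _ G \<longleftrightarrow> simple_graph G \<and>
     (\<forall>(H :: 'b ugraph) f. simple_graph H \<longrightarrow> cut_continuous G H f \<longrightarrow> induced_by_hom G H f)"

definition cc_le :: "'a ugraph \<Rightarrow> 'b ugraph \<Rightarrow> bool"  (infix "\<preceq>cc" 50) where
  "G \<preceq>cc H \<longleftrightarrow> (\<exists>f. cut_continuous G H f)"

definition cc_equiv :: "'a ugraph \<Rightarrow> 'b ugraph \<Rightarrow> bool"  (infix "\<approx>cc" 50) where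
  "G \<approx>cc H \<longleftrightarrow> G \<preceq>cc H \<and> H \<preceq>cc G"

definition cc_less :: "'a ugraph \<Rightarrow> 'b ugraph \<Rightarrow> bool"  (infix "\<prec>cc" 50) where
  "G \<prec>cc H \<longleftrightarrow> G \<preceq>cc H \<and> \<not> H \<preceq>cc G"

definition complete_graph :: "nat \<Rightarrow> nat ugraph" where
  "complete_graph n = \<lparr>verts = {1..n}, edges = {e. e \<subseteq> {1..n} \<and> card e = 2}\<rparr>"

definition graphs_on :: "'a set \<Rightarrow> 'a ugraph set" where
  "graphs_on V = {G. simple_graph G \<and> verts G = V}"

definition random_graph :: "nat \<Rightarrow> nat ugraph pmf" where
  "random_graph n = pmf_of_set (graphs_on {1..n})"

definition graph_iso :: "'a ugraph \<Rightarrow> 'b ugraph \<Rightarrow> bool" where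
  "graph_iso G H \<longleftrightarrow> (\<exists>\<phi>. bij_betw \<phi> (verts G) (verts H) \<and>
     (\<forall>u\<in>verts G. \<forall>v\<in>verts G. {u, v} \<in> edges G \<longleftrightarrow> {\<phi> u, \<phi> v} \<in> edges H))"

text \<open>
  The countable random graph has vertex set \<^typ>\<open>nat\<close>, and each of its potential edges is present
  independently with probability 1/2. The Rado graph is the graph, unique up to isomorphism, to
  which it is almost surely isomorphic.
\<close>
definition countable_coin_space :: "(nat set \<Rightarrow> bool) measure" where
  "countable_coin_space = (\<Pi>\<^sub>M e\<in>{e. card e = 2}. measure_pmf (bernoulli_pmf (1/2)))"

definition countable_graph_of :: "(nat set \<Rightarrow> bool) \<Rightarrow> nat ugraph" where
  "countable_graph_of \<omega> = \<lparr>verts = UNIV, edges = {e. card e = 2 \<and> \<omega> e}\<rparr>"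

definition rado_graph :: "'a ugraph \<Rightarrow> bool" where
  "rado_graph R \<longleftrightarrow> simple_graph R \<and>
     (AE \<omega> in countable_coin_space. graph_iso (countable_graph_of \<omega>) R)"

lemma finite_graphs_on: "finite V \<Longrightarrow> finite (graphs_on V)"
  and card_graphs_on: "finite V \<Longrightarrow> card (graphs_on V) = 2 ^ (card V choose 2)"
proof -
  assume V: "finite V"
  let ?P = "{e. e \<subseteq> V \<and> card e = 2}"
  have eq: "graphs_on V = (\<lambda>E. \<lparr>verts = V, edges = E\<rparr>) ` Pow ?P"
  proof (intro set_eqI iffI)
    fix G assume "G \<in> graphs_on V"
    then have "edges G \<in> Pow ?P" "G = \<lparr>verts = V, edges = edges G\<rparr>"
      by (auto simp: graphs_on_def simple_graph_def)
    then show "G \<in> (\<lambda>E. \<lparr>verts = V, edges = E\<rparr>) ` Pow ?P" by blast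
  next
    fix G assume "G \<in> (\<lambda>E. \<lparr>verts = V, edges = E\<rparr>) ` Pow ?P"
    then obtain E where "E \<subseteq> ?P" "G = \<lparr>verts = V, edges = E\<rparr>" by blast
    then show "G \<in> graphs_on V"
      unfolding graphs_on_def simple_graph_def by (simp add: subset_iff)
  qed
  have fin: "finite ?P" using V by simp
  show "finite (graphs_on V)" unfolding eq using fin by blast
  have inj: "inj_on (\<lambda>E. \<lparr>verts = V, edges = E\<rparr>) (Pow ?P)" by (auto simp: inj_on_def)
  show "card (graphs_on V) = 2 ^ (card V choose 2)"
    unfolding eq card_image[OF inj] card_Pow[OF fin] using n_subsets[OF V, of 2] by simp
qed

lemma pmf_random_graph:
  assumes "G \<in> graphs_on {1..n}"
  shows "pmf (random_graph n) G = 1 / 2 ^ (n choose 2)"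
proof -
  have "graphs_on {1..n} \<noteq> {}" using assms by blast
  then show ?thesis
    using assms by (simp add: random_graph_def finite_graphs_on card_graphs_on)
qed

lemma homotens_nat_imp:
  fixes G :: "'a ugraph"
  assumes ctb: "countable (edges G)" and hom: "homotens TYPE(nat) G"
  shows "homotens TYPE('b) G"
  unfolding homotens_def
proof (intro conjI allI impI)
  show G: "simple_graph G" using hom by (simp add: homotens_def)
  fix H :: "'b ugraph" and f
  assume H: "simple_graph H" and f: "cut_continuous G H f"
  have fE: "f e \<in> edges H" if "e \<in> edges G" for e
    using f that by (auto simp: cut_continuous_def)
  define W where "W = \<Union> (f ` edges G)"
  have fin: "finite (f e)" if "e \<in> edges G" for e
    using H fE[OF that] by (metis card.infinite simple_graph_def zero_neq_numeral)
  have "countable W"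
    unfolding W_def using ctb fin by (auto intro!: countable_UN intro: countable_finite)
  define t where "t = to_nat_on W"
  have inj: "inj_on t W" unfolding t_def using \<open>countable W\<close> by (rule inj_on_to_nat_on)
  have fW: "f e \<subseteq> W" if "e \<in> edges G" for e using that by (auto simp: W_def)
  have WV: "W \<subseteq> verts H" using H fE unfolding W_def simple_graph_def by blast
  define K :: "nat ugraph" where "K = \<lparr>verts = t ` W, edges = (\<lambda>e. t ` f e) ` edges G\<rparr>"
  have K: "simple_graph K"
    unfolding simple_graph_def
  proof
    fix d assume "d \<in> edges K"
    then obtain e where e: "e \<in> edges G" "d = t ` f e" by (auto simp: K_def)
    have "card (f e) = 2" using H fE[OF e(1)] by (simp add: simple_graph_def)
    then have "card d = 2" unfolding e(2) using inj_on_subset[OF inj fW[OF e(1)]] by (simp add: card_image)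
    moreover have "d \<subseteq> verts K" unfolding e(2) K_def using fW[OF e(1)] by (simp add: image_mono)
    ultimately show "d \<subseteq> verts K \<and> card d = 2" by simp
  qed
  have "cut_continuous G K (\<lambda>e. t ` f e)"
    unfolding cut_continuous_def
  proof (intro conjI allI impI)
    show "(\<lambda>e. t ` f e) \<in> edges G \<rightarrow> edges K" by (auto simp: K_def)
    fix C assume "is_cut K C"
    then obtain X where X: "X \<subseteq> t ` W" "C = cut_of K X" by (auto simp: is_cut_def K_def)
    define Y where "Y = {w \<in> W. t w \<in> X}"
    have eqv: "t ` f e \<in> C \<longleftrightarrow> f e \<in> cut_of H Y" if e: "e \<in> edges G" for e
    proof
      assume "t ` f e \<in> C"
      then obtain x y where xy: "x \<in> X" "y \<in> t ` W - X" "t ` f e = {x, y}"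
        unfolding X(2) cut_of_def by (auto simp: K_def)
      obtain u where u: "u \<in> f e" "t u = x" using xy(3) by (metis imageE insertI1)
      obtain v where v: "v \<in> f e" "t v = y" using xy(3) by (metis imageE insertCI)
      have "card (f e) = 2" using H fE[OF e] by (auto simp: simple_graph_def)
      moreover have "u \<noteq> v" using u v xy by auto
      ultimately have "f e = {u, v}"
        using u v by (metis card_2_iff doubleton_eq_iff empty_iff insertE)
      moreover have "u \<in> Y" "v \<in> verts H - Y"
        using u v xy fW[OF e] WV by (auto simp: Y_def)
      ultimately show "f e \<in> cut_of H Y" using fE[OF e] unfolding cut_of_def by blast
    next
      assume "f e \<in> cut_of H Y"
      then obtain u v where uv: "u \<in> Y" "v \<in> verts H - Y" "f e = {u, v}"
        unfolding cut_of_def by blast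
      have "v \<in> W" using fW[OF e] uv by auto
      then have "t u \<in> X" "t v \<in> t ` W - X" "t ` f e = {t u, t v}"
        using uv by (auto simp: Y_def)
      then show "t ` f e \<in> C" unfolding X(2) cut_of_def using e by (auto simp: K_def)
    qed
    have "Y \<subseteq> verts H" using WV by (auto simp: Y_def)
    then have "is_cut H (cut_of H Y)" unfolding is_cut_def by (intro exI[of _ Y] conjI refl)
    then have "is_cut G {e \<in> edges G. f e \<in> cut_of H Y}" using f by (simp add: cut_continuous_def)
    moreover have "{e \<in> edges G. t ` f e \<in> C} = {e \<in> edges G. f e \<in> cut_of H Y}"
      using eqv by auto
    ultimately show "is_cut G {e \<in> edges G. t ` f e \<in> C}" by simp
  qed
  then have "induced_by_hom G K (\<lambda>e. t ` f e)" using hom K by (simp add: homotens_def)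
  then obtain h where h: "graph_hom G K h"
    and ht: "\<And>u v. {u, v} \<in> edges G \<Longrightarrow> t ` f {u, v} = {h u, h v}"
    unfolding induced_by_hom_def by blast
  define g where "g = inv_into W t \<circ> h"
  have fg: "f {u, v} = {g u, g v}" if e: "{u, v} \<in> edges G" for u v
  proof -
    have "f {u, v} = inv_into W t ` t ` f {u, v}"
      using inv_into_image_cancel[OF inj fW[OF e]] by simp
    also have "\<dots> = {g u, g v}" by (simp add: ht[OF e] g_def)
    finally show ?thesis .
  qed
  have "g \<in> verts G \<rightarrow> verts H"
  proof
    fix v assume "v \<in> verts G"
    then have "h v \<in> t ` W" using h by (auto simp: graph_hom_def K_def)
    then have "g v \<in> W" unfolding g_def by (simp add: inv_into_into)
    then show "g v \<in> verts H" using WV by blast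
  qed
  moreover have "{g u, g v} \<in> edges H" if "{u, v} \<in> edges G" for u v
    using fE[OF that] fg[OF that] by simp
  ultimately have "graph_hom G H g" by (simp add: graph_hom_def)
  then show "induced_by_hom G H f" using fg unfolding induced_by_hom_def by blast
qed

end

theory Submission
  imports Defs "HOL-Real_Asymp.Real_Asymp"
begin

text \<open>
  A cut-continuous map sends triangles to triangles, since a triangle meets the preimage of every
  vertex star in an even number of edges. Hence on each \<open>K\<^sub>4\<close> it is either induced by an injection of
  the vertices or it identifies opposite edges, and the second case is impossible when the \<open>K\<^sub>4\<close> lies in a
  \<open>K\<^sub>5\<close>. If any four vertices of \<open>G\<close> have a common neighbour, then every triangle lies in a \<open>K\<^sub>4\<close>, every
  \<open>K\<^sub>4\<close> in a \<open>K\<^sub>5\<close>, and any two triangles at a vertex are linked through copies of \<open>K\<^sub>4\<close>, so that the local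
  vertex maps fit together to a homomorphism. This extension property holds for \<open>K\<^sub>n\<close> with \<open>n \<ge> 5\<close>, almost surely for
  the countable random graph, and for the uniformly random graph on
  \<open>n\<close> vertices it fails with probability at most \<open>n\<^sup>4 (15/16)\<^sup>n\<^sup>-\<^sup>4\<close>.
\<close>

subsection \<open>Cut-continuous maps and common neighbours\<close>

lemma edge_in_cut_of_iff:
  assumes "simple_graph G" "{u, v} \<in> edges G"
  shows "{u, v} \<in> cut_of G X \<longleftrightarrow> (u \<in> X) \<noteq> (v \<in> X)"
proof -
  have "u \<in> verts G" "v \<in> verts G" using assms by (auto simp: simple_graph_def)
  then show ?thesis using assms(2) by (fastforce simp: cut_of_def doubleton_eq_iff)
qed

lemma simple_graph_edgeE:
  assumes "simple_graph G" "e \<in> edges G"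
  obtains u v where "e = {u, v}" "u \<noteq> v" "u \<in> verts G" "v \<in> verts G"
  using assms by (force simp: simple_graph_def card_2_iff)

lemma simple_graph_edgeD:
  assumes "simple_graph G" "{u, v} \<in> edges G"
  shows "u \<in> verts G" "v \<in> verts G" "u \<noteq> v"
  using assms by (force simp: simple_graph_def)+

lemma edge_in_cut_of_singleton_iff:
  assumes "simple_graph G" "e \<in> edges G"
  shows "e \<in> cut_of G {x} \<longleftrightarrow> x \<in> e"
proof -
  obtain u v where "e = {u, v}" "u \<noteq> v" using simple_graph_edgeE[OF assms] .
  then show ?thesis using edge_in_cut_of_iff[of G u v "{x}"] assms by auto
qed

section \<open>Images of triangles and of complete graphs on four vertices\<close>

text \<open>Three edges that sum to zero modulo 2. Preimages of vertex stars control edges only up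
  to parity, so this is the form in which triangles are transported.\<close>

definition triangle :: "'a set \<Rightarrow> 'a set \<Rightarrow> 'a set \<Rightarrow> bool" where
  "triangle A B C \<longleftrightarrow> card A = 2 \<and> card B = 2 \<and> card C = 2 \<and> sym_diff A B = C"

text \<open>Two 2-sets whose symmetric difference has two elements share exactly one element, and
  that element is \<open>b\<close>.\<close>

lemma triangleE:
  assumes "triangle A B C"
  obtains a b c where "distinct [a, b, c]" "A = {a, b}" "B = {b, c}" "C = {a, c}"
proof -
  obtain p q where A: "A = {p, q}" "p \<noteq> q" using assms by (auto simp: triangle_def card_2_iff)
  obtain r s where B: "B = {r, s}" "r \<noteq> s" using assms by (auto simp: triangle_def card_2_iff)
  have C: "sym_diff A B = C" "card C = 2" using assms by (auto simp: triangle_def)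
  have "card (A \<union> B) = 2 + card (A \<inter> B)"
  proof -
    have "card (sym_diff A B) + card (A \<inter> B) = card (A \<union> B)"
      using A B by (subst card_Un_disjoint[symmetric]) (auto intro!: arg_cong[of _ _ card])
    then show ?thesis using C by simp
  qed
  moreover have "card (A \<union> B) + card (A \<inter> B) = 4"
    using card_Un_Int[of A B] A B by simp
  ultimately have "card (A \<inter> B) = 1" by simp
  then obtain b where b: "A \<inter> B = {b}" using card_1_singletonE by blast
  have "b \<in> A" "b \<in> B" using b by blast+
  obtain a where a: "A = {a, b}" "a \<noteq> b"
    using A \<open>b \<in> A\<close> by (metis insertE singletonD insert_commute)
  obtain c where c: "B = {b, c}" "c \<noteq> b"
    using B \<open>b \<in> B\<close> by (metis insertE singletonD insert_commute)
  have "a \<noteq> c" using b a c by auto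
  moreover from this have "C = {a, c}" using C(1) a c by auto
  ultimately show ?thesis using a c by (intro that[of a b c]) auto
qed

text \<open>For two image triangles over a common edge \<open>{a, b}\<close> that label it in the
  same direction; \<open>W\<close> is the image of the sixth edge of a \<open>K_4\<close>.\<close>

lemma sym_diff_aligned:
  assumes "distinct [a, b, c]" "distinct [a, b, d]" "W = sym_diff {a, c} {a, d}" "card W = 2"
  shows "d \<noteq> c" "W = {c, d}"
proof -
  show "d \<noteq> c"
  proof
    assume "d = c"
    then have "W = {}" using assms(3) by simp
    then show False using assms(4) by simp
  qed
  then show "W = {c, d}" using assms by auto
qed

text \<open>The opposite labelling of the common edge: a fresh \<open>d\<close> would give
  \<open>W\<close> four elements, so the two apexes coincide.\<close>

lemma sym_diff_crossed:
  assumes "distinct [a, b, c]" "distinct [b, a, d]" "W = sym_diff {a, c} {b, d}" "card W = 2"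
  shows "d = c" "W = {a, b}"
proof -
  show "d = c"
  proof (rule ccontr)
    assume "d \<noteq> c"
    then have "W = {a, c, b, d}" using assms by auto
    moreover have "card {a, c, b, d} = 4" using assms(1,2) \<open>d \<noteq> c\<close> by auto
    ultimately show False using assms(4) by simp
  qed
  then show "W = {a, b}" using assms by auto
qed

locale cut_continuous_map =
  fixes G :: "'a ugraph" and H :: "'b ugraph" and f
  assumes G: "simple_graph G" and H: "simple_graph H" and f: "cut_continuous G H f"
begin

abbreviation adj :: "'a \<Rightarrow> 'a \<Rightarrow> bool" (infix "\<sim>" 50) where
  "u \<sim> v \<equiv> {u, v} \<in> edges G"

lemma adj_sym: "u \<sim> v \<longleftrightarrow> v \<sim> u"
  by (simp add: insert_commute)

lemma image_edge: "e \<in> edges G \<Longrightarrow> f e \<in> edges H"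
  using f by (auto simp: cut_continuous_def)

lemma card_image_edge: "e \<in> edges G \<Longrightarrow> card (f e) = 2"
  using H image_edge by (auto simp: simple_graph_def)

text \<open>The star of \<open>x\<close> pulls back to the cut of some \<open>Y\<close>, so whether
  \<open>x\<close> lies in \<open>f {p, q}\<close> is the sum modulo 2 of the indicators of
  \<open>p\<close> and \<open>q\<close> in \<open>Y\<close>. Around a triangle every vertex is
  counted twice.\<close>

lemma triangle_image:
  assumes "u \<sim> v" "v \<sim> w" "u \<sim> w"
  shows "triangle (f {u, v}) (f {v, w}) (f {u, w})"
proof -
  have "x \<in> f {u, w} \<longleftrightarrow> (x \<in> f {u, v}) \<noteq> (x \<in> f {v, w})" for x
  proof (cases "x \<in> verts H")
    case True
    then have "is_cut H (cut_of H {x})" by (auto simp: is_cut_def)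
    then have "is_cut G {e \<in> edges G. f e \<in> cut_of H {x}}"
      using f by (simp add: cut_continuous_def)
    then obtain Y where Y: "{e \<in> edges G. f e \<in> cut_of H {x}} = cut_of G Y"
      by (auto simp: is_cut_def)
    have "x \<in> f {p, q} \<longleftrightarrow> (p \<in> Y) \<noteq> (q \<in> Y)" if "p \<sim> q" for p q
      using edge_in_cut_of_iff[OF G that, of Y] that
        edge_in_cut_of_singleton_iff[OF H image_edge[OF that], of x]
      unfolding Y[symmetric] by blast
    from this[OF assms(1)] this[OF assms(2)] this[OF assms(3)] show ?thesis by blast
  next
    case False
    then have "x \<notin> f e" if "e \<in> edges G" for e
      using image_edge[OF that] H by (auto simp: simple_graph_def)
    then show ?thesis using assms by blast
  qed
  then show ?thesis
    unfolding triangle_def using assms card_image_edge by blast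
qed

text \<open>Label the image of \<open>uvw\<close> by \<open>a\<close>, \<open>b\<close>,
  \<open>c\<close>. The image of \<open>uvx\<close> shares the edge \<open>{a, b}\<close> with it;
  the two possible directions of that edge give the two outcomes.\<close>

lemma K4_image:
  assumes "u \<sim> v" "u \<sim> w" "u \<sim> x" "v \<sim> w" "v \<sim> x" "w \<sim> x"
  obtains (inj) a b c d where "distinct [a, b, c, d]"
      "f {u, v} = {a, b}" "f {u, w} = {a, c}" "f {u, x} = {a, d}"
      "f {v, w} = {b, c}" "f {v, x} = {b, d}" "f {w, x} = {c, d}"
    | (collapse) "f {u, v} = f {w, x}" "f {u, w} = f {v, x}" "f {u, x} = f {v, w}"
proof -
  obtain a b c where abc: "distinct [a, b, c]"
    and uv: "f {u, v} = {a, b}" and vw: "f {v, w} = {b, c}" and uw: "f {u, w} = {a, c}"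
    using triangleE[OF triangle_image[OF assms(1,4,2)]] .
  have uvx: "triangle {a, b} (f {v, x}) (f {u, x})"
    using triangle_image[OF assms(1,5,3)] uv by simp
  have uwx: "triangle {a, c} (f {w, x}) (f {u, x})"
    using triangle_image[OF assms(2,6,3)] uw by simp
  obtain p q d where pqd: "distinct [p, q, d]" "{a, b} = {p, q}"
    and vx: "f {v, x} = {q, d}" and ux: "f {u, x} = {p, d}"
    using triangleE[OF uvx] .
  \<comment> \<open>The remaining edge is forced by the triangle \<open>uwx\<close>, and its
    cardinality restricts \<open>d\<close>.\<close>
  have wx: "f {w, x} = sym_diff {a, c} {p, d}" "card (f {w, x}) = 2"
    using uwx ux by (auto simp: triangle_def)
  from pqd(2) consider "p = a" "q = b" | "p = b" "q = a" by (auto simp: doubleton_eq_iff)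
  then show ?thesis
  proof cases
    case 1
    have abd: "distinct [a, b, d]" using pqd(1) unfolding 1 .
    have d: "d \<noteq> c" "f {w, x} = {c, d}"
      by (rule sym_diff_aligned[OF abc abd wx[unfolded 1]])+
    have "distinct [a, b, c, d]" using abc abd d(1) by simp
    from this uv uw ux[unfolded 1] vw vx[unfolded 1] d(2) show ?thesis by (rule inj)
  next
    case 2
    have bad: "distinct [b, a, d]" using pqd(1) unfolding 2 .
    have d: "d = c" "f {w, x} = {a, b}"
      by (rule sym_diff_crossed[OF abc bad wx[unfolded 2]])+
    have "f {u, v} = f {w, x}" unfolding uv d(2) ..
    moreover have "f {u, w} = f {v, x}" unfolding uw vx 2 d(1) ..
    moreover have "f {u, x} = f {v, w}" unfolding ux vw 2 d(1) ..
    ultimately show ?thesis by (rule collapse)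
  qed
qed

text \<open>If \<open>uvwx\<close> collapses, look at \<open>uvwy\<close>. If that one is injective,
  the triangle \<open>uxy\<close> gets the disjoint sides \<open>{b, c}\<close> and
  \<open>{a, d}\<close>; if it collapses too, the sides \<open>wx\<close> and \<open>wy\<close> of a
  triangle get equal images.\<close>

lemma K4_image_inj:
  assumes "u \<sim> v" "u \<sim> w" "u \<sim> x" "v \<sim> w" "v \<sim> x" "w \<sim> x"
    and y: "u \<sim> y" "v \<sim> y" "w \<sim> y" "x \<sim> y"
  obtains a b c d where "distinct [a, b, c, d]"
      "f {u, v} = {a, b}" "f {u, w} = {a, c}" "f {u, x} = {a, d}"
      "f {v, w} = {b, c}" "f {v, x} = {b, d}" "f {w, x} = {c, d}"
  using assms(1-6)
proof (cases rule: K4_image)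
  case inj
  then show ?thesis using that by blast
next
  case collapse
  note K = collapse
  have False
    using assms(1,2) y(1) assms(4) y(2,3)
  proof (cases rule: K4_image)
    case (inj a b c d)
    have "triangle (f {u, x}) (f {x, y}) (f {u, y})" using assms(3) y(1,4) by (intro triangle_image)
    then have "triangle {b, c} (f {x, y}) {a, d}" using K inj by simp
    then show False
      using inj(1) by (elim triangleE) (auto simp: doubleton_eq_iff)
  next
    case collapse
    then have "f {w, x} = f {w, y}" using K by simp
    moreover have "triangle (f {w, x}) (f {x, y}) (f {w, y})"
      using assms(6) y(3,4) by (intro triangle_image)
    ultimately show False by (elim triangleE) (auto simp: doubleton_eq_iff)
  qed
  then show ?thesis ..
qed

end

section \<open>The extension property and the gluing of the vertex maps\<close>

text \<open>The four vertices may coincide, so common neighbours of fewer vertices are covered as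
  well.\<close>

definition four_extension :: "'a ugraph \<Rightarrow> bool" where
  "four_extension G \<longleftrightarrow> (\<forall>a\<in>verts G. \<forall>b\<in>verts G. \<forall>c\<in>verts G. \<forall>d\<in>verts G.
     \<exists>z. {z, a} \<in> edges G \<and> {z, b} \<in> edges G \<and> {z, c} \<in> edges G \<and> {z, d} \<in> edges G)"

context cut_continuous_map
begin

text \<open>The image of the vertex \<open>v\<close> as seen from the triangle \<open>vuw\<close>.\<close>

definition corner :: "'a \<Rightarrow> 'a \<Rightarrow> 'a \<Rightarrow> 'b" where
  "corner v u w = the_elem (f {v, u} \<inter> f {v, w})"

lemma corner_commute: "corner v u w = corner v w u"
  by (simp add: corner_def Int_commute)

lemma corner_eqI: "f {v, u} = {a, b} \<Longrightarrow> f {v, w} = {a, c} \<Longrightarrow> distinct [a, b, c] \<Longrightarrow> corner v u w = a"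
proof -
  assume "f {v, u} = {a, b}" "f {v, w} = {a, c}" "distinct [a, b, c]"
  then have "f {v, u} \<inter> f {v, w} = {a}" by auto
  then show "corner v u w = a" by (simp add: corner_def)
qed

text \<open>The point is that \<open>corner v u w\<close> depends on \<open>v\<close> alone. The
  facts \<open>K4\<close>, \<open>edge\<close> and \<open>vertex\<close> free it step by step from
  the choice of the triangle.\<close>

lemma induced_by_hom_if_four_extension:
  assumes ext: "four_extension G"
  shows "induced_by_hom G H f"
proof -
  have V: "u \<in> verts G" "v \<in> verts G" if "u \<sim> v" for u v
    using simple_graph_edgeD[OF G that] by auto
  have ext': "\<exists>z. a \<sim> z \<and> b \<sim> z \<and> c \<sim> z \<and> d \<sim> z"
    if "a \<in> verts G" "b \<in> verts G" "c \<in> verts G" "d \<in> verts G" for a b c d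
    using ext that unfolding four_extension_def by (metis adj_sym)
  have K4: "corner v u w = corner v u x"
    if adj: "v \<sim> u" "v \<sim> w" "v \<sim> x" "u \<sim> w" "u \<sim> x" "w \<sim> x" for v u w x
  proof -
    obtain y where "v \<sim> y" "u \<sim> y" "w \<sim> y" "x \<sim> y" using ext' V adj by metis
    with adj show ?thesis
    proof (cases rule: K4_image_inj)
      case (1 a b c d)
      then have "corner v u w = a" "corner v u x = a"
        using corner_eqI[of v u a b w c] corner_eqI[of v u a b x d] by simp_all
      then show ?thesis by simp
    qed
  qed
  have edge: "corner v u w = corner v u w'"
    if adj: "v \<sim> u" "v \<sim> w" "u \<sim> w" "v \<sim> w'" "u \<sim> w'" for v u w w'
  \<comment> \<open>\<open>y\<close> creates two copies of \<open>K_4\<close>, on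
    \<open>v, u, w, y\<close> and \<open>v, u, w', y\<close>, that share the triangle
    \<open>vuy\<close>.\<close>
  proof -
    obtain y where "v \<sim> y" "u \<sim> y" "w \<sim> y" "w' \<sim> y" using ext' V adj by metis
    then show ?thesis using K4[of v u w y] K4[of v u w' y] adj by simp
  qed
  have vertex: "corner v u w = corner v u' w'"
    if adj: "v \<sim> u" "v \<sim> w" "u \<sim> w" "v \<sim> u'" "v \<sim> w'" "u' \<sim> w'" for v u w u' w'
  proof -
    \<comment> \<open>The triangles \<open>vux\<close> and \<open>vxu'\<close> share the edge
      \<open>vx\<close> and link the two given triangles.\<close>
    obtain x where x: "v \<sim> x" "u \<sim> x" "u' \<sim> x" using ext' V adj by metis
    have "corner v u w = corner v x u" using edge[of v u w x] adj x corner_commute by metis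
    also have "\<dots> = corner v x u'" using edge[of v x u u'] adj x by (simp add: adj_sym)
    also have "\<dots> = corner v u' w'" using edge[of v u' x w'] adj x corner_commute by metis
    finally show ?thesis .
  qed
  \<comment> \<open>Any triangle at \<open>v\<close> may be chosen, by \<open>vertex\<close>;
    outside \<open>verts G\<close> the value is arbitrary.\<close>
  define h where "h v = (SOME a. \<exists>u w. v \<sim> u \<and> v \<sim> w \<and> u \<sim> w \<and> a = corner v u w)" for v
  have h: "h v = corner v u w" if adj: "v \<sim> u" "v \<sim> w" "u \<sim> w" for v u w
  proof -
    have "\<exists>a u w. v \<sim> u \<and> v \<sim> w \<and> u \<sim> w \<and> a = corner v u w" using adj by blast
    then have "\<exists>u w. v \<sim> u \<and> v \<sim> w \<and> u \<sim> w \<and> h v = corner v u w"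
      unfolding h_def by (rule someI_ex)
    then show ?thesis using vertex adj by metis
  qed
  have fh: "f {u, v} = {h u, h v}" if adj: "u \<sim> v" for u v
  proof -
    \<comment> \<open>A single triangle over the edge \<open>uv\<close> yields the corners at both
      of its ends.\<close>
    obtain w where w: "u \<sim> w" "v \<sim> w" using ext' V[OF adj] by metis
    obtain a b c where abc: "distinct [a, b, c]" "f {u, v} = {a, b}" "f {v, w} = {b, c}" "f {u, w} = {a, c}"
      using triangleE[OF triangle_image[OF adj w(2,1)]] .
    have "corner u v w = a" using abc corner_eqI[of u v a b w c] by simp
    moreover have "corner v u w = b"
      using abc corner_eqI[of v u b a w c] by (auto simp: insert_commute)
    ultimately show ?thesis using abc(2) h[of u v w] h[of v u w] adj w by (simp add: adj_sym)
  qed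
  have hV: "h v \<in> verts H" if v: "v \<in> verts G" for v
  proof -
    obtain u where "v \<sim> u" using ext' v by metis
    then have "{h v, h u} \<in> edges H" using fh image_edge by metis
    then show ?thesis using simple_graph_edgeD[OF H] by blast
  qed
  have "graph_hom G H h"
    unfolding graph_hom_def using hV fh image_edge by (metis Pi_I)
  then show ?thesis using fh unfolding induced_by_hom_def by blast
qed

end

lemma homotens_if_four_extension:
  assumes "simple_graph G" "four_extension G"
  shows "homotens TYPE('b) G"
  unfolding homotens_def
proof (intro conjI allI impI)
  fix H :: "'b ugraph" and f
  assume "simple_graph H" "cut_continuous G H f"
  then interpret cut_continuous_map G H f using assms by unfold_locales
  show "induced_by_hom G H f" using assms(2) by (rule induced_by_hom_if_four_extension)
qed fact

section \<open>Construction of cut-continuous maps\<close>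

text \<open>Reduces cut-continuity to a parity test at the endpoints. It serves maps that come from
  homomorphisms and also the map from \<open>K_4\<close> to \<open>K_3\<close>, which comes from
  none.\<close>

lemma cut_continuousI:
  assumes G: "simple_graph G" and H: "simple_graph H"
    and f: "\<And>e. e \<in> edges G \<Longrightarrow> f e \<in> edges H"
    and cut: "\<And>X. \<exists>Y\<subseteq>verts G. \<forall>u v. {u, v} \<in> edges G \<longrightarrow>
      f {u, v} \<in> cut_of H X \<longleftrightarrow> (u \<in> Y) \<noteq> (v \<in> Y)"
  shows "cut_continuous G H f"
  unfolding cut_continuous_def
proof (intro conjI allI impI)
  show "f \<in> edges G \<rightarrow> edges H" using f by blast
  fix C assume "is_cut H C"
  then obtain X where X: "C = cut_of H X" by (auto simp: is_cut_def)
  obtain Y where Y: "Y \<subseteq> verts G"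
    "\<forall>u v. {u, v} \<in> edges G \<longrightarrow> f {u, v} \<in> cut_of H X \<longleftrightarrow> (u \<in> Y) \<noteq> (v \<in> Y)"
    using cut[of X] by auto
  have "e \<in> cut_of G Y \<longleftrightarrow> f e \<in> C" if e: "e \<in> edges G" for e
  proof -
    obtain u v where uv: "e = {u, v}" using simple_graph_edgeE[OF G e] .
    then show ?thesis using edge_in_cut_of_iff[OF G, of u v Y] Y(2) e X by simp
  qed
  moreover have "cut_of G Y \<subseteq> edges G" by (auto simp: cut_of_def)
  ultimately have "{e \<in> edges G. f e \<in> C} = cut_of G Y" by auto
  then show "is_cut G {e \<in> edges G. f e \<in> C}" using Y(1) by (auto simp: is_cut_def)
qed

text \<open>The cut of \<open>X\<close> pulls back to the cut of the vertex preimage of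
  \<open>X\<close> under \<open>h\<close>.\<close>

lemma cc_le_if_graph_hom:
  assumes G: "simple_graph G" and H: "simple_graph H" and h: "graph_hom G H h"
  shows "G \<preceq>cc H"
proof -
  have hE: "{h u, h v} \<in> edges H" if "{u, v} \<in> edges G" for u v
    using h that by (simp add: graph_hom_def)
  have "cut_continuous G H (image h)"
  proof (rule cut_continuousI[OF G H])
    show "h ` e \<in> edges H" if e: "e \<in> edges G" for e
    proof -
      obtain u v where "e = {u, v}" using simple_graph_edgeE[OF G e] .
      then show ?thesis using hE[of u v] e by simp
    qed
    show "\<exists>Y\<subseteq>verts G. \<forall>u v. {u, v} \<in> edges G \<longrightarrow>
        h ` {u, v} \<in> cut_of H X \<longleftrightarrow> (u \<in> Y) \<noteq> (v \<in> Y)" for X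
    proof (intro exI[of _ "{v \<in> verts G. h v \<in> X}"] conjI allI impI)
      fix u v assume uv: "{u, v} \<in> edges G"
      show "h ` {u, v} \<in> cut_of H X \<longleftrightarrow>
          (u \<in> {v \<in> verts G. h v \<in> X}) \<noteq> (v \<in> {v \<in> verts G. h v \<in> X})"
        using edge_in_cut_of_iff[OF H hE[OF uv], of X] simple_graph_edgeD[OF G uv] by simp
    qed simp
  qed
  then show ?thesis unfolding cc_le_def by blast
qed

subsection \<open>Complete graphs\<close>

lemma verts_complete_graph [simp]: "verts (complete_graph n) = {1..n}"
  by (simp add: complete_graph_def)

lemma adj_complete_graph:
  "{u, v} \<in> edges (complete_graph n) \<longleftrightarrow> u \<in> {1..n} \<and> v \<in> {1..n} \<and> u \<noteq> v"
  by (auto simp: complete_graph_def card_2_iff doubleton_eq_iff)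

lemma simple_complete_graph: "simple_graph (complete_graph n)"
  by (simp add: simple_graph_def complete_graph_def)

lemma four_extension_complete_graph:
  assumes "n \<ge> 5"
  shows "four_extension (complete_graph n)"
  unfolding four_extension_def
proof (intro ballI)
  fix a b c d assume *: "a \<in> verts (complete_graph n)" "b \<in> verts (complete_graph n)"
    "c \<in> verts (complete_graph n)" "d \<in> verts (complete_graph n)"
  have "card {a, b, c, d} \<le> 4" using card_length[of "[a, b, c, d]"] by simp
  then have "\<not> {1..n} \<subseteq> {a, b, c, d}" using card_mono[of "{a, b, c, d}" "{1..n}"] assms by auto
  then obtain z where "z \<in> {1..n}" "z \<notin> {a, b, c, d}" by blast
  then show "\<exists>z. {z, a} \<in> edges (complete_graph n) \<and> {z, b} \<in> edges (complete_graph n) \<and>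
      {z, c} \<in> edges (complete_graph n) \<and> {z, d} \<in> edges (complete_graph n)"
    using * unfolding adj_complete_graph by (intro exI[of _ z]) simp
qed

lemma complete_graph_mono_cc:
  assumes "m \<le> n"
  shows "complete_graph m \<preceq>cc complete_graph n"
proof -
  have "graph_hom (complete_graph m) (complete_graph n) id"
    using assms by (auto simp: graph_hom_def adj_complete_graph)
  then show ?thesis by (intro cc_le_if_graph_hom simple_complete_graph)
qed

text \<open>As the larger graph is homotens, a cut-continuous map would come from a homomorphism.
  This is injective on a complete graph, since the target has no loops, and the vertex counts forbid
  it.\<close>

lemma not_complete_graph_cc_le:
  assumes "n \<ge> 5" "m < n"
  shows "\<not> complete_graph n \<preceq>cc complete_graph m"
proof
  assume "complete_graph n \<preceq>cc complete_graph m"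
  then obtain f where "cut_continuous (complete_graph n) (complete_graph m) f"
    by (auto simp: cc_le_def)
  moreover have "homotens TYPE(nat) (complete_graph n)"
    using assms(1) by (intro homotens_if_four_extension simple_complete_graph four_extension_complete_graph)
  ultimately have "induced_by_hom (complete_graph n) (complete_graph m) f"
    using simple_complete_graph[of m] by (simp add: homotens_def)
  then obtain h where h: "graph_hom (complete_graph n) (complete_graph m) h"
    by (auto simp: induced_by_hom_def)
  have "inj_on h {1..n}"
    using h unfolding inj_on_def graph_hom_def adj_complete_graph by metis
  moreover have "h ` {1..n} \<subseteq> {1..m}" using h by (auto simp: graph_hom_def)
  ultimately have "card {1..n} \<le> card {1..m}" by (intro card_inj_on_le) auto
  then show False using assms(2) by simp
qed

text \<open>The map induced by the proper 3-edge-colouring of \<open>K\<^sub>4\<close> by its perfect matchings. The stars of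
  \<open>1\<close>, \<open>2\<close>, \<open>3\<close> in \<open>K\<^sub>3\<close> pull back to the cuts of \<open>{1, 4}\<close>, \<open>{1, 3}\<close>, \<open>{1, 2}\<close>; \<open>Y\<close> is their sum modulo 2.\<close>

lemma complete_graph_4_cc_le_3: "complete_graph 4 \<preceq>cc complete_graph 3"
proof -
  define f :: "nat set \<Rightarrow> nat set" where
    \<comment> \<open>The last branch takes the matching \<open>{1, 4}\<close>,
      \<open>{2, 3}\<close> and also every non-edge, so all values of \<open>f\<close> are edges of
      \<open>K_3\<close>.\<close>
    "f e = (if e \<in> {{1, 2}, {3, 4}} then {1, 2} else if e \<in> {{1, 3}, {2, 4}} then {1, 3} else {2, 3})" for e
  define Y :: "nat set \<Rightarrow> nat set" where
    "Y X = {v. v = 1 \<and> (1 \<in> X) \<noteq> ((2 \<in> X) \<noteq> (3 \<in> X)) \<or>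
      v = 2 \<and> 3 \<in> X \<or> v = 3 \<and> 2 \<in> X \<or> v = 4 \<and> 1 \<in> X}" for X
  have "cut_continuous (complete_graph 4) (complete_graph 3) f"
  proof (rule cut_continuousI[OF simple_complete_graph simple_complete_graph])
    show "f e \<in> edges (complete_graph 3)" for e
      by (simp add: f_def adj_complete_graph)
    show "\<exists>Y\<subseteq>verts (complete_graph 4). \<forall>u v. {u, v} \<in> edges (complete_graph 4) \<longrightarrow>
        f {u, v} \<in> cut_of (complete_graph 3) X \<longleftrightarrow> (u \<in> Y) \<noteq> (v \<in> Y)" for X
    proof (intro exI[of _ "Y X"] conjI allI impI)
      show "Y X \<subseteq> verts (complete_graph 4)" by (auto simp: Y_def)
      fix u v :: nat assume uv: "{u, v} \<in> edges (complete_graph 4)"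
      have *: "u \<in> {1, 2, 3, 4}" "v \<in> {1, 2, 3, 4}" "u \<noteq> v"
        using uv by (auto simp: adj_complete_graph)
      have cut: "{p, q} \<in> cut_of (complete_graph 3) X \<longleftrightarrow> (p \<in> X) \<noteq> (q \<in> X)"
        if "p \<in> {1..3}" "q \<in> {1..3}" "p \<noteq> q" for p q
        using that by (intro edge_in_cut_of_iff simple_complete_graph) (simp add: adj_complete_graph)
      have cuts: "{1, 2} \<in> cut_of (complete_graph 3) X \<longleftrightarrow> (1 \<in> X) \<noteq> (2 \<in> X)"
        "{1, 3} \<in> cut_of (complete_graph 3) X \<longleftrightarrow> (1 \<in> X) \<noteq> (3 \<in> X)"
        "{2, 3} \<in> cut_of (complete_graph 3) X \<longleftrightarrow> (2 \<in> X) \<noteq> (3 \<in> X)"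
        by (intro cut; simp)+
      have Y: "1 \<in> Y X \<longleftrightarrow> (1 \<in> X) \<noteq> ((2 \<in> X) \<noteq> (3 \<in> X))" "2 \<in> Y X \<longleftrightarrow> 3 \<in> X"
        "3 \<in> Y X \<longleftrightarrow> 2 \<in> X" "4 \<in> Y X \<longleftrightarrow> 1 \<in> X"
        by (simp_all add: Y_def)
      have *: "(u, v) \<in> {(1,2),(2,1),(3,4),(4,3),(1,3),(3,1),(2,4),(4,2),(1,4),(4,1),(2,3),(3,2)}"
        using * by auto
      have f: "f {1, 2} = {1, 2}" "f {3, 4} = {1, 2}" "f {1, 3} = {1, 3}" "f {2, 4} = {1, 3}"
        "f {1, 4} = {2, 3}" "f {2, 3} = {2, 3}"
        by (simp_all add: f_def doubleton_eq_iff)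
      then have f': "f {2, 1} = {1, 2}" "f {4, 3} = {1, 2}" "f {3, 1} = {1, 3}" "f {4, 2} = {1, 3}"
        "f {4, 1} = {2, 3}" "f {3, 2} = {2, 3}"
        by (simp_all add: insert_commute)
      show "f {u, v} \<in> cut_of (complete_graph 3) X \<longleftrightarrow> (u \<in> Y X) \<noteq> (v \<in> Y X)"
        using * by (elim insertE; simp add: f f' cuts Y del: One_nat_def; blast?)
    qed
  qed
  then show ?thesis unfolding cc_le_def by blast
qed

subsection \<open>Random graphs\<close>

abbreviation pairs :: "nat set set" where
  "pairs \<equiv> {e. card e = 2}"

text \<open>The \<open>rewrites\<close> clause folds the product measure, so that the inherited
  facts speak of \<open>countable_coin_space\<close>.\<close>

interpretation coin: product_prob_space "\<lambda>_. measure_pmf (bernoulli_pmf (1/2))" pairs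
  rewrites "(\<Pi>\<^sub>M e\<in>pairs. measure_pmf (bernoulli_pmf (1/2))) = countable_coin_space"
  by unfold_locales (simp_all add: countable_coin_space_def)

lemma coin_measurable [measurable]:
  "e \<in> pairs \<Longrightarrow> (\<lambda>\<omega>. \<omega> e) \<in> measurable countable_coin_space (count_space UNIV)"
  using measurable_component_singleton[of e pairs "\<lambda>_. measure_pmf (bernoulli_pmf (1/2))"]
  unfolding countable_coin_space_def by simp

lemma coin_cylinder_measurable:
  assumes "finite J" "J \<subseteq> pairs"
  shows "{\<omega> \<in> space countable_coin_space. \<forall>e\<in>J. \<omega> e = b e} \<in> sets countable_coin_space"
proof -
  have "{\<omega> \<in> space countable_coin_space. \<omega> e = b e} \<in> sets countable_coin_space" if "e \<in> J" for e
    using measurable_sets[OF coin_measurable[of e], of "{b e}"] that assms(2)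
    by (auto simp: vimage_def Int_def conj_commute)
  then show ?thesis using assms(1) by (rule sets.sets_Collect_finite_All)
qed

lemma coin_cylinder_prob:
  assumes "finite J" "J \<subseteq> pairs"
  shows "measure countable_coin_space {\<omega> \<in> space countable_coin_space. \<forall>e\<in>J. \<omega> e = b e} = (1/2) ^ card J"
proof -
  have half: "measure (measure_pmf (bernoulli_pmf (1/2))) {c} = 1/2" for c
    by (cases c) (simp_all add: measure_pmf_single)
  have "{\<omega> \<in> space countable_coin_space. \<forall>e\<in>J. \<omega> e = b e} =
    prod_emb pairs (\<lambda>_. measure_pmf (bernoulli_pmf (1/2))) J (\<Pi>\<^sub>E e\<in>J. {b e})"
    unfolding prod_emb_def countable_coin_space_def using assms by (auto simp: space_PiM Pi_iff)
  then show ?thesis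
    using coin.measure_PiM_emb[of J "\<lambda>e. {b e}"] assms by (simp add: half)
qed

text \<open>The joint law of the coordinates is the whole measure, which is the product of their
  marginals.\<close>

lemma coin_indep: "coin.P.indep_vars (\<lambda>_. count_space UNIV) (\<lambda>e \<omega>. \<omega> e) pairs"
proof -
  have ne: "pairs \<noteq> {}" by (auto intro!: exI[of _ "{0, 1}"])
  have 1: "distr countable_coin_space (count_space UNIV) (\<lambda>\<omega>. \<omega> e) = measure_pmf (bernoulli_pmf (1/2))"
    if "e \<in> pairs" for e
    using coin.PiM_component[OF that] by (metis distr_cong sets_measure_pmf_count_space)
  have "distr countable_coin_space (\<Pi>\<^sub>M e\<in>pairs. count_space UNIV) (\<lambda>\<omega>. \<lambda>e\<in>pairs. \<omega> e) = countable_coin_space"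
  proof -
    have "sets (\<Pi>\<^sub>M e\<in>pairs. count_space UNIV) = sets countable_coin_space"
      unfolding countable_coin_space_def by (intro sets_PiM_cong) auto
    \<comment> \<open>Points of the product space are extensional, so the joint map is the
      identity.\<close>
    moreover have "(\<lambda>e\<in>pairs. \<omega> e) = \<omega>" if "\<omega> \<in> space countable_coin_space" for \<omega>
      using that unfolding countable_coin_space_def space_PiM PiE_def
      by (intro extensional_restrict) simp
    ultimately have "distr countable_coin_space (\<Pi>\<^sub>M e\<in>pairs. count_space UNIV) (\<lambda>\<omega>. \<lambda>e\<in>pairs. \<omega> e)
        = distr countable_coin_space countable_coin_space (\<lambda>\<omega>. \<omega>)"
      by (intro distr_cong) auto
    then show ?thesis by (simp add: distr_id)
  qed
  also have "\<dots> = (\<Pi>\<^sub>M e\<in>pairs. distr countable_coin_space (count_space UNIV) (\<lambda>\<omega>. \<omega> e))"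
    by (subst countable_coin_space_def) (intro PiM_cong refl, simp only: 1)
  finally show ?thesis
    by (subst coin.P.indep_vars_iff_distr_eq_PiM'[OF ne coin_measurable]) simp_all
qed

section \<open>Probability that a common neighbour is missing\<close>

text \<open>Different \<open>z\<close> use disjoint blocks \<open>K z\<close> of coins because
  \<open>Z\<close> and \<open>S\<close> are disjoint. Hence the events that \<open>z\<close> misses
  some vertex of \<open>S\<close> are independent, each of probability
  \<open>1 - (1/2) ^ card S\<close>.\<close>

lemma prob_no_common_neighbour:
  assumes Z: "finite Z" and S: "finite S" and disj: "Z \<inter> S = {}"
  shows "{\<omega> \<in> space countable_coin_space. \<forall>z\<in>Z. \<exists>s\<in>S. \<not> \<omega> {z, s}} \<in> sets countable_coin_space"
      (is "?E \<in> _")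
    and "measure countable_coin_space {\<omega> \<in> space countable_coin_space. \<forall>z\<in>Z. \<exists>s\<in>S. \<not> \<omega> {z, s}}
      = (1 - (1/2) ^ card S) ^ card Z"
proof -
  let ?M = countable_coin_space
  define K where "K z = (\<lambda>s. {z, s}) ` S" for z
  have K: "K z \<subseteq> pairs" "finite (K z)" "card (K z) = card S" if "z \<in> Z" for z
  proof -
    have "z \<noteq> s" if "s \<in> S" for s using \<open>z \<in> Z\<close> that disj by blast
    then show "K z \<subseteq> pairs" by (auto simp: K_def)
    show "finite (K z)" using S by (simp add: K_def)
    have "inj_on (\<lambda>s. {z, s}) S" by (auto simp: inj_on_def doubleton_eq_iff)
    then show "card (K z) = card S" unfolding K_def by (rule card_image)
  qed
  have dK: "disjoint_family_on K Z"
    using disj unfolding disjoint_family_on_def K_def by (fastforce simp: doubleton_eq_iff)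
  define A where "A z = {\<omega> \<in> space ?M. \<forall>e\<in>K z. \<omega> e = True}" for z
  have A: "A z \<in> sets ?M" "measure ?M (space ?M - A z) = 1 - (1/2) ^ card S" if "z \<in> Z" for z
  proof -
    show "A z \<in> sets ?M"
      unfolding A_def using K[OF that] by (intro coin_cylinder_measurable)
    then show "measure ?M (space ?M - A z) = 1 - (1/2) ^ card S"
      using coin_cylinder_prob[of "K z" "\<lambda>_. True"] K[OF that] by (simp add: coin.P.prob_compl A_def)
  qed
  have E: "?E = {\<omega> \<in> space ?M. \<forall>z\<in>Z. \<omega> \<in> space ?M - A z}"
    unfolding A_def K_def by auto
  show "?E \<in> sets ?M"
    unfolding E using A(1) Z by (intro sets.sets_Collect_finite_All) (auto simp: Int_def[symmetric] intro!: sets.Diff)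
  show "measure ?M ?E = (1 - (1/2) ^ card S) ^ card Z"
  \<comment> \<open>The product rule for independent variables wants a nonempty index set.\<close>
  proof (cases "Z = {}")
    case True
    then show ?thesis by (simp add: coin.P.prob_space)
  next
    case False
    let ?N = "\<lambda>z. \<Pi>\<^sub>M e\<in>K z. count_space (UNIV :: bool set)"
    let ?X = "\<lambda>z \<omega>. restrict (\<lambda>e. \<omega> e) (K z)"
    \<comment> \<open>The failure event at \<open>z\<close>, stated on the block \<open>K z\<close>
      alone, so that independence of the restrictions applies.\<close>
    define B where "B z = {x \<in> space (?N z). \<not> (\<forall>e\<in>K z. x e)}" for z
    have B: "B z \<in> sets (?N z)" if "z \<in> Z" for z
      unfolding B_def using K(2)[OF that] by measurable
    have XB: "?X z -` B z \<inter> space ?M = space ?M - A z" if "z \<in> Z" for z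
      by (auto simp: B_def A_def space_PiM)
    have "coin.P.indep_vars ?N ?X Z"
      using coin_indep K(1) dK by (rule coin.P.indep_vars_restrict)
    then have "measure ?M (\<Inter>z\<in>Z. ?X z -` B z \<inter> space ?M) = (\<Prod>z\<in>Z. measure ?M (?X z -` B z \<inter> space ?M))"
      using False Z B by (intro coin.P.indep_varsD) auto
    also have "(\<Inter>z\<in>Z. ?X z -` B z \<inter> space ?M) = ?E" using False XB unfolding E by auto
    also have "(\<Prod>z\<in>Z. measure ?M (?X z -` B z \<inter> space ?M)) = (\<Prod>z\<in>Z. 1 - (1/2) ^ card S)"
      using XB A(2) by (intro prod.cong) auto
    finally show ?thesis by simp
  qed
qed

text \<open>Coincidences among \<open>a\<close>, \<open>b\<close>, \<open>c\<close>,
  \<open>d\<close> only lower the failure probability and leave more candidates, so one bound covers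
  all cases. For small \<open>V\<close> the exponent truncates to 0.\<close>

lemma prob_no_common_neighbour_le:
  fixes V :: "nat set"
  assumes V: "finite V"
  shows "measure countable_coin_space {\<omega> \<in> space countable_coin_space.
      \<forall>z\<in>V - {a, b, c, d}. \<exists>s\<in>{a, b, c, d}. \<not> \<omega> {z, s}} \<le> (15/16) ^ (card V - 4)"
proof -
  let ?S = "{a, b, c, d}"
  have S: "card ?S \<le> 4" using card_length[of "[a, b, c, d]"] by simp
  then have Z: "card V - 4 \<le> card (V - ?S)" using diff_card_le_card_Diff[of ?S V] by simp
  have "(1/2::real) ^ 4 \<le> (1/2) ^ card ?S" using S by (intro power_decreasing) auto
  then have "1 - (1/2::real) ^ card ?S \<le> 15/16" by (simp add: power_divide)
  moreover have "0 \<le> 1 - (1/2::real) ^ card ?S" by (simp add: power_le_one)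
  ultimately have "(1 - (1/2::real) ^ card ?S) ^ card (V - ?S) \<le> (15/16) ^ card (V - ?S)"
    by (intro power_mono)
  also have "\<dots> \<le> (15/16) ^ (card V - 4)" using Z by (intro power_decreasing) auto
  finally show ?thesis using prob_no_common_neighbour(2)[of "V - ?S" ?S] V by simp
qed

section \<open>The countable random graph\<close>

text \<open>Failure on all of \<nat> implies failure on each initial segment, whose probability
  tends to 0. There are only countably many quadruples, so the null sets can be united.\<close>

lemma AE_four_extension: "AE \<omega> in countable_coin_space. four_extension (countable_graph_of \<omega>)"
proof -
  have "AE \<omega> in countable_coin_space. \<exists>z. z \<notin> {a, b, c, d} \<and> (\<forall>s\<in>{a, b, c, d}. \<omega> {z, s})" for a b c d :: nat
  proof -
    let ?S = "{a, b, c, d}"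
    let ?E = "\<lambda>V. {\<omega> \<in> space countable_coin_space. \<forall>z\<in>V - ?S. \<exists>s\<in>?S. \<not> \<omega> {z, s}}"
    have E: "?E V \<in> sets countable_coin_space" if "finite V" for V
      using that by (intro prob_no_common_neighbour) auto
    have eq: "?E UNIV = (\<Inter>n. ?E {..<n})" by auto
    have UE: "?E UNIV \<in> sets countable_coin_space" unfolding eq using E by auto
    have "measure countable_coin_space (?E UNIV) \<le> (15/16) ^ (n - 4)" for n
    proof -
      have "measure countable_coin_space (?E UNIV) \<le> measure countable_coin_space (?E {..<n})"
        using E by (intro coin.P.finite_measure_mono) auto
      also have "\<dots> \<le> (15/16) ^ (n - 4)" using prob_no_common_neighbour_le[of "{..<n}"] by simp
      finally show ?thesis .
    qed
    moreover have "(\<lambda>n. (15/16::real) ^ (n - 4)) \<longlonglongrightarrow> 0"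
      by (rule LIMSEQ_offset[of _ 4]) (simp add: LIMSEQ_realpow_zero)
    ultimately have "measure countable_coin_space (?E UNIV) \<le> 0"
      by (intro LIMSEQ_le_const) auto
    then have "measure countable_coin_space (?E UNIV) = 0"
      by (intro antisym measure_nonneg)
    then have "?E UNIV \<in> null_sets countable_coin_space"
      using UE unfolding null_sets_def coin.P.emeasure_eq_measure by simp
    then show ?thesis by (rule AE_I') auto
  qed
  then have "AE \<omega> in countable_coin_space. \<forall>a b c d. \<exists>z. z \<notin> {a, b, c, d} \<and> (\<forall>s\<in>{a, b, c, d}. \<omega> {z, s})"
    unfolding AE_all_countable by (intro allI)
  then show ?thesis
  proof (rule AE_mp, intro AE_I2 impI)
    fix \<omega> :: "nat set \<Rightarrow> bool" assume *: "\<forall>a b c d. \<exists>z. z \<notin> {a, b, c, d} \<and> (\<forall>s\<in>{a, b, c, d}. \<omega> {z, s})"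
    show "four_extension (countable_graph_of \<omega>)"
      unfolding four_extension_def
    proof (intro ballI)
      fix a b c d
      \<comment> \<open>\<open>z\<close> avoids the four vertices, so each \<open>{z, s}\<close> has
        two elements and is an edge.\<close>
      obtain z where "z \<notin> {a, b, c, d}" "\<forall>s\<in>{a, b, c, d}. \<omega> {z, s}" using * by blast
      then show "\<exists>z. {z, a} \<in> edges (countable_graph_of \<omega>) \<and> {z, b} \<in> edges (countable_graph_of \<omega>) \<and>
          {z, c} \<in> edges (countable_graph_of \<omega>) \<and> {z, d} \<in> edges (countable_graph_of \<omega>)"
        by (intro exI[of _ z]) (simp add: countable_graph_of_def)
    qed
  qed
qed

section \<open>The finite random graphs\<close>

text \<open>Realises the finite random graphs for all \<open>n\<close> on the one coin space, where
  the bound on missing neighbours is available.\<close>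

definition initial_graph :: "nat \<Rightarrow> (nat set \<Rightarrow> bool) \<Rightarrow> nat ugraph" where
  "initial_graph n \<omega> = \<lparr>verts = {1..n}, edges = {e. e \<subseteq> {1..n} \<and> card e = 2 \<and> \<omega> e}\<rparr>"

text \<open>Each graph on \<open>{1..n}\<close> is a cylinder over \<open>n choose 2\<close> coins,
  hence has its uniform probability; every event is a finite disjoint union of these.\<close>

lemma random_graph_prob:
  shows "{\<omega> \<in> space countable_coin_space. initial_graph n \<omega> \<in> A} \<in> sets countable_coin_space"
    and "measure_pmf.prob (random_graph n) A =
      measure countable_coin_space {\<omega> \<in> space countable_coin_space. initial_graph n \<omega> \<in> A}"
proof -
  let ?M = countable_coin_space
  let ?J = "{e. e \<subseteq> {1..n} \<and> card e = 2}"
  define F where "F G = {\<omega> \<in> space ?M. initial_graph n \<omega> = G}" for G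
  have J: "finite ?J" "?J \<subseteq> pairs" "card ?J = n choose 2"
    using n_subsets[of "{1..n}" 2] by auto
  have F: "F G = {\<omega> \<in> space ?M. \<forall>e\<in>?J. \<omega> e = (e \<in> edges G)}" if "G \<in> graphs_on {1..n}" for G
  proof -
    have G: "verts G = {1..n}" "edges G \<subseteq> ?J"
      using that by (auto simp: graphs_on_def simple_graph_def)
    have "initial_graph n \<omega> = G \<longleftrightarrow> (\<forall>e\<in>?J. \<omega> e = (e \<in> edges G))" for \<omega>
    proof -
      have "initial_graph n \<omega> = G \<longleftrightarrow> {e \<in> ?J. \<omega> e} = edges G"
        using G(1) by (cases G) (simp add: initial_graph_def conj_assoc)
      also have "\<dots> \<longleftrightarrow> (\<forall>e\<in>?J. \<omega> e = (e \<in> edges G))"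
        using G(2) by blast
      finally show ?thesis .
    qed
    then show ?thesis unfolding F_def by simp
  qed
  have FM: "F G \<in> sets ?M" "measure ?M (F G) = 1 / 2 ^ (n choose 2)" if "G \<in> graphs_on {1..n}" for G
    using coin_cylinder_measurable[OF J(1,2)] coin_cylinder_prob[OF J(1,2)]
    unfolding F[OF that] J(3) by (simp_all add: power_one_over)
  have range: "initial_graph n \<omega> \<in> graphs_on {1..n}" for \<omega>
    by (auto simp: initial_graph_def graphs_on_def simple_graph_def)
  have fin: "finite (graphs_on {1..n})" by (simp add: finite_graphs_on)
  have eq: "{\<omega> \<in> space ?M. initial_graph n \<omega> \<in> A} = (\<Union>G\<in>A \<inter> graphs_on {1..n}. F G)"
    using range by (auto simp: F_def)
  show "{\<omega> \<in> space ?M. initial_graph n \<omega> \<in> A} \<in> sets ?M"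
    unfolding eq using FM fin by (intro sets.finite_UN) auto
  have "measure ?M (\<Union>G\<in>A \<inter> graphs_on {1..n}. F G) = (\<Sum>G\<in>A \<inter> graphs_on {1..n}. measure ?M (F G))"
    using FM fin by (intro coin.P.finite_measure_finite_Union) (auto simp: disjoint_family_on_def F_def)
  also have "\<dots> = (\<Sum>G\<in>A \<inter> graphs_on {1..n}. pmf (random_graph n) G)"
    using FM by (intro sum.cong) (auto simp: pmf_random_graph)
  also have "\<dots> = measure_pmf.prob (random_graph n) (A \<inter> graphs_on {1..n})"
    using fin by (simp add: measure_measure_pmf_finite)
  also have "\<dots> = measure_pmf.prob (random_graph n) A"
  proof -
    have "graphs_on {1..n} \<noteq> {}" using range by blast
    then have "set_pmf (random_graph n) = graphs_on {1..n}"
      using fin by (simp add: random_graph_def)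
    then show ?thesis by (metis measure_Int_set_pmf)
  qed
  finally show "measure_pmf.prob (random_graph n) A = measure ?M {\<omega> \<in> space ?M. initial_graph n \<omega> \<in> A}"
    unfolding eq by simp
qed

text \<open>Union bound over the \<open>n ^ 4\<close> quadruples.\<close>

lemma random_graph_four_extension:
  "measure_pmf.prob (random_graph n) {G. \<not> four_extension G} \<le> real n ^ 4 * (15/16) ^ (n - 4)"
proof -
  let ?M = countable_coin_space
  let ?V = "{1..n}"
  let ?E = "\<lambda>(a, b, c, d). {\<omega> \<in> space ?M. \<forall>z\<in>?V - {a, b, c, d}. \<exists>s\<in>{a, b, c, d}. \<not> \<omega> {z, s}}"
  let ?Q = "?V \<times> ?V \<times> ?V \<times> ?V"
  have E: "?E q \<in> sets ?M" for q
    by (cases q) (auto intro!: prob_no_common_neighbour(1))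
  have "{\<omega> \<in> space ?M. initial_graph n \<omega> \<in> {G. \<not> four_extension G}} \<subseteq> (\<Union>q\<in>?Q. ?E q)"
  proof
    fix \<omega> assume \<omega>: "\<omega> \<in> {\<omega> \<in> space ?M. initial_graph n \<omega> \<in> {G. \<not> four_extension G}}"
    then obtain a b c d where abcd: "a \<in> ?V" "b \<in> ?V" "c \<in> ?V" "d \<in> ?V"
      and no: "\<And>z. \<not> ({z, a} \<in> edges (initial_graph n \<omega>) \<and> {z, b} \<in> edges (initial_graph n \<omega>) \<and>
        {z, c} \<in> edges (initial_graph n \<omega>) \<and> {z, d} \<in> edges (initial_graph n \<omega>))"
      unfolding four_extension_def by (auto simp: initial_graph_def)
    have "\<exists>s\<in>{a, b, c, d}. \<not> \<omega> {z, s}" if "z \<in> ?V - {a, b, c, d}" for z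
      using no[of z] that abcd by (auto simp: initial_graph_def)
    then have "\<omega> \<in> ?E (a, b, c, d)" using \<omega> by simp
    moreover have "(a, b, c, d) \<in> ?Q" using abcd by simp
    ultimately show "\<omega> \<in> (\<Union>q\<in>?Q. ?E q)" by (rule UN_I[rotated])
  qed
  then have "measure_pmf.prob (random_graph n) {G. \<not> four_extension G} \<le> measure ?M (\<Union>q\<in>?Q. ?E q)"
    unfolding random_graph_prob(2) using E by (intro coin.P.finite_measure_mono sets.finite_UN) auto
  also have "\<dots> \<le> (\<Sum>q\<in>?Q. measure ?M (?E q))"
    using E by (intro coin.P.finite_measure_subadditive_finite) auto
  also have "\<dots> \<le> (\<Sum>q\<in>?Q. (15/16) ^ (n - 4))"
    using prob_no_common_neighbour_le[of ?V] by (intro sum_mono) auto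
  also have "\<dots> = real n ^ 4 * (15/16) ^ (n - 4)"
    by (simp add: card_cartesian_product power4_eq_xxxx)
  finally show ?thesis .
qed

lemma random_graph_homotens:
  "(\<lambda>n. measure_pmf.prob (random_graph n) {G. homotens TYPE('b) G}) \<longlonglongrightarrow> 1"
proof (rule tendsto_sandwich[where h = "\<lambda>_. 1"])
  show "\<forall>\<^sub>F n in sequentially. 1 - real n ^ 4 * (15/16) ^ (n - 4) \<le>
      measure_pmf.prob (random_graph n) {G. homotens TYPE('b) G}"
  proof (intro always_eventually allI)
    fix n
    have "measure_pmf.prob (random_graph n) {G. four_extension G}
        \<le> measure_pmf.prob (random_graph n) {G. homotens TYPE('b) G}"
    proof (unfold random_graph_prob(2), intro coin.P.finite_measure_mono random_graph_prob(1) subsetI)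
      fix \<omega> assume *: "\<omega> \<in> {\<omega> \<in> space countable_coin_space. initial_graph n \<omega> \<in> {G. four_extension G}}"
      have "simple_graph (initial_graph n \<omega>)" by (simp add: initial_graph_def simple_graph_def)
      then show "\<omega> \<in> {\<omega> \<in> space countable_coin_space. initial_graph n \<omega> \<in> {G. homotens TYPE('b) G}}"
        using * by (auto intro: homotens_if_four_extension)
    qed
    moreover have "measure_pmf.prob (random_graph n) {G. four_extension G} =
        1 - measure_pmf.prob (random_graph n) {G. \<not> four_extension G}"
      using measure_pmf.prob_compl[of "{G. \<not> four_extension G}" "random_graph n"]
      by (simp add: Collect_neg_eq Compl_eq_Diff_UNIV[symmetric])
    ultimately show "1 - real n ^ 4 * (15/16) ^ (n - 4) \<le>
        measure_pmf.prob (random_graph n) {G. homotens TYPE('b) G}"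
      using random_graph_four_extension[of n] by linarith
  qed
  show "(\<lambda>n. 1 - real n ^ 4 * (15/16) ^ (n - 4)) \<longlonglongrightarrow> 1"
  \<comment> \<open>Shifting by 4 removes the truncated subtraction in the exponent.\<close>
  proof (rule LIMSEQ_offset[of _ 4])
    have "(\<lambda>n. real (n + 4) ^ 4 * (15/16) ^ n) \<longlonglongrightarrow> 0" by real_asymp
    then show "(\<lambda>n. 1 - real (n + 4) ^ 4 * (15/16) ^ (n + 4 - 4)) \<longlonglongrightarrow> 1"
      using tendsto_diff[OF tendsto_const, of "\<lambda>n. real (n + 4) ^ 4 * (15/16) ^ n" 0 sequentially 1] by simp
  qed
qed simp_all

section \<open>The Rado graph and the conclusion\<close>

lemma simple_graph_iso_four_extension:
  assumes G: "simple_graph G" and iso: "graph_iso G R" and ext: "four_extension G"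
  shows "four_extension R"
proof -
  obtain \<phi> where \<phi>: "bij_betw \<phi> (verts G) (verts R)"
    "\<And>u v. u \<in> verts G \<Longrightarrow> v \<in> verts G \<Longrightarrow> {u, v} \<in> edges G \<longleftrightarrow> {\<phi> u, \<phi> v} \<in> edges R"
    using iso by (auto simp: graph_iso_def)
  have R: "verts R = \<phi> ` verts G" using \<phi>(1) by (simp add: bij_betw_def)
  show ?thesis
    unfolding four_extension_def R
  proof (intro ballI)
    fix a' b' c' d'
    assume "a' \<in> \<phi> ` verts G" "b' \<in> \<phi> ` verts G" "c' \<in> \<phi> ` verts G" "d' \<in> \<phi> ` verts G"
    then obtain a b c d where *: "a \<in> verts G" "b \<in> verts G" "c \<in> verts G" "d \<in> verts G"
      and eq: "a' = \<phi> a" "b' = \<phi> b" "c' = \<phi> c" "d' = \<phi> d" by blast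
    then obtain z where z: "{z, a} \<in> edges G" "{z, b} \<in> edges G" "{z, c} \<in> edges G" "{z, d} \<in> edges G"
      using ext unfolding four_extension_def by meson
    \<comment> \<open>\<open>\<phi>\<close> respects adjacency only between vertices of
      \<open>G\<close>.\<close>
    then have "z \<in> verts G" using simple_graph_edgeD[OF G] by blast
    then show "\<exists>z. {z, a'} \<in> edges R \<and> {z, b'} \<in> edges R \<and> {z, c'} \<in> edges R \<and> {z, d'} \<in> edges R"
      unfolding eq using z * \<phi>(2) by (intro exI[of _ "\<phi> z"]) simp
  qed
qed

lemma rado_graph_homotens:
  assumes "rado_graph R"
  shows "homotens TYPE('b) R"
proof -
  have R: "simple_graph R" "AE \<omega> in countable_coin_space. graph_iso (countable_graph_of \<omega>) R"
    using assms by (auto simp: rado_graph_def)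
  \<comment> \<open>This statement does not mention \<omega>, so holding almost surely in a
    probability space makes it true.\<close>
  have "AE \<omega> in countable_coin_space. four_extension R"
    using AE_four_extension R(2)
  proof eventually_elim
    case (elim \<omega>)
    have "simple_graph (countable_graph_of \<omega>)"
      by (simp add: countable_graph_of_def simple_graph_def)
    then show ?case using elim(2,1) by (rule simple_graph_iso_four_extension)
  qed
  then have "four_extension R" by (simp add: coin.P.AE_const)
  then show ?thesis by (rule homotens_if_four_extension[OF R(1)])
qed

theorem corollary5:
  shows "((\<lambda>n. measure_pmf.prob (random_graph n) {G. homotens TYPE('b) G}) \<longlonglongrightarrow> 1)
    \<and> (\<forall>R :: 'a ugraph. rado_graph R \<longrightarrow> homotens TYPE('b) R)
    \<and> (\<forall>n\<ge>5. homotens TYPE('b) (complete_graph n))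
    \<and> complete_graph 3 \<approx>cc complete_graph 4
    \<and> (\<forall>n\<ge>4. complete_graph n \<prec>cc complete_graph (n + 1))"
proof (intro conjI allI impI)
  show "(\<lambda>n. measure_pmf.prob (random_graph n) {G. homotens TYPE('b) G}) \<longlonglongrightarrow> 1"
    by (rule random_graph_homotens)
  show "homotens TYPE('b) R" if "rado_graph R" for R :: "'a ugraph"
    using that by (rule rado_graph_homotens)
  show "homotens TYPE('b) (complete_graph n)" if "n \<ge> 5" for n
    using that
    by (intro homotens_if_four_extension simple_complete_graph four_extension_complete_graph)
  show "complete_graph 3 \<approx>cc complete_graph 4"
    unfolding cc_equiv_def using complete_graph_4_cc_le_3 complete_graph_mono_cc[of 3 4] by simp
  \<comment> \<open>Strictness rests on \<open>K_(n+1)\<close> being homotens;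
    \<open>n + 1 \<ge> 5\<close> holds exactly from \<open>n = 4\<close> on.\<close>
  show "complete_graph n \<prec>cc complete_graph (n + 1)" if "n \<ge> 4" for n
    unfolding cc_less_def
    using that complete_graph_mono_cc[of n "n + 1"] not_complete_graph_cc_le[of "n + 1" n] by simp
qed

end
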